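(* Let $d\ge 1$, let $\Sigma\in\mathbb{R}^{d\times d}$ be symmetric positive semidefinite and let $C\in\mathbb{R}^{d\times d}$. Let $x$ be a mean-zero random vector in $\mathbb{R}^d$ that is $(\Sigma,C)$-subgamma, i.e. for every $v\in\mathbb{R}^d$, $$ \mathbb{E}\left[e^{\lambda\langle x,v\rangle}\right] \le e^{\lambda^2 v^T\Sigma v/2}\qquad\text{for all real } \lambda \text{ with } |\lambda|\le \frac{1}{\|Cv\|}. $$ Then for every $t>0$, $$ \Pr\left[\|x\| \ge \sqrt{\mathrm{Tr}(\Sigma)} + t\right] \le 2\exp\left(-\frac{1}{16}\min\left(\frac{t^2}{\|\Sigma\|},\ \frac{t}{\|C\|},\ \frac{2t\sqrt{\mathrm{Tr}(\Sigma)}+t^2}{\|C\|_F^2}\right)\right). $$ Consequently, for every $0<\delta<1$, with probability at least $1-\delta$, $$ \|x\| \le \sqrt{\mathrm{Tr}(\Sigma)} + 4\sqrt{\|\Sigma\|\log\frac{2}{\delta}} + 16\|C\|\log\frac{2}{\delta} + \min\left(4\|C\|_F\sqrt{\log\frac{2}{\delta}},\ \frac{8\|C\|_F^2}{\sqrt{\mathrm{Tr}(\Sigma)}}\log\frac{2}{\delta}\right). $$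
   Context: For vectors $\|\cdot\|$ is the Euclidean norm; for matrices $\|\cdot\|$ is the operator norm and $\|\cdot\|_F$ the Frobenius norm. Fractions with zero denominator are read as $+\infty$ (so if $Cv=0$ the moment bound holds for all real $\lambda$). *)

theory Defs
  imports "HOL-Probability.Probability"
begin

definition pos_semidef :: "real^'d^'d \<Rightarrow> bool" where
  "pos_semidef A \<longleftrightarrow> transpose A = A \<and> (\<forall>v. v \<bullet> (A *v v) \<ge> 0)"

abbreviation op_norm :: "real^'d^'d \<Rightarrow> real" where
  "op_norm A \<equiv> onorm (\<lambda>v. A *v v)"

definition frob_norm :: "real^'d^'d \<Rightarrow> real" where
  "frob_norm A = sqrt (\<Sum>i\<in>UNIV. \<Sum>j\<in>UNIV. (A $ i $ j)\<^sup>2)"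

text \<open>Fractions with zero denominator are read as \<open>\<infinity>\<close>, whatever the numerator;
  \<^typ>\<open>ereal\<close> division instead gives \<open>0 / 0 = 0\<close>.\<close>

definition frac_inf :: "real \<Rightarrow> real \<Rightarrow> ereal" where
  "frac_inf a b = (if b = 0 then \<infinity> else ereal (a / b))"

definition exp_ereal :: "ereal \<Rightarrow> ereal" where
  "exp_ereal x = (case x of ereal r \<Rightarrow> ereal (exp r) | PInfty \<Rightarrow> \<infinity> | MInfty \<Rightarrow> 0)"

text \<open>Integrability is part of the moment bound: the Bochner integral of a non-integrable
  function is \<open>0\<close>, whereas here its expectation is \<open>\<infinity>\<close>.\<close>

definition subgamma :: "'a measure \<Rightarrow> ('a \<Rightarrow> real^'d) \<Rightarrow> real^'d^'d \<Rightarrow> real^'d^'d \<Rightarrow> bool" where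
  "subgamma M x S C \<longleftrightarrow>
    (\<forall>v l. ereal \<bar>l\<bar> \<le> frac_inf 1 (norm (C *v v)) \<longrightarrow>
       integrable M (\<lambda>\<omega>. exp (l * (x \<omega> \<bullet> v))) \<and>
       (\<integral>\<omega>. exp (l * (x \<omega> \<bullet> v)) \<partial>M) \<le> exp (l\<^sup>2 * (v \<bullet> (S *v v)) / 2))"

end

theory Submission
  imports Defs
begin

text \<open>
  Rescaling \<open>v\<close> turns the moment condition into \<open>E exp (x \<bullet> v) \<le> exp (v \<bullet> S v / 2)\<close> on the convex symmetric
  set \<open>\<parallel>C v\<parallel> \<le> 1\<close>. Multiply by the Gaussian weight \<open>g v = exp (- (v \<bullet> S v + \<alpha> \<parallel>v\<parallel>\<^sup>2) / 2)\<close> and integrate over that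
  set: by Fubini the expectation of \<open>\<integral> exp (x \<bullet> v) g v dv\<close> is at most the isotropic integral
  \<open>Z\<^sub>\<alpha> = \<integral> exp (- \<alpha> \<parallel>v\<parallel>\<^sup>2 / 2) dv\<close>. Conversely, if \<open>\<parallel>x\<parallel> \<ge> s\<close>, recentring at \<open>\<theta> x / \<parallel>x\<parallel>\<close> and restricting to
  \<open>\<parallel>C w\<parallel> \<le> r\<close> with \<open>\<theta> \<parallel>C\<parallel> + r \<le> 1\<close> bounds the inner integral from below by
  \<open>exp (\<theta> s - \<theta>\<^sup>2 (\<parallel>S\<parallel> + \<alpha>) / 2)\<close> times the mass of \<open>g\<close> on \<open>\<parallel>C w\<parallel> \<le> r\<close>. That mass is at least half the total
  as soon as \<open>4 \<parallel>C\<parallel>\<^sub>F\<^sup>2 \<le> r\<^sup>2 \<alpha>\<close>, and the total is at least \<open>exp (- Tr S / (2 \<alpha>)) Z\<^sub>\<alpha>\<close>. Taking \<open>\<theta>\<close>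
  proportional to the target exponent over \<open>t\<close> and \<open>\<alpha> = (sqrt (Tr S) + t / 2) / \<theta>\<close> gives the tail bound.
\<close>

subsection \<open>Gaussian integrals\<close>

text \<open>The integrand is a constant multiple of the centred normal density with variance
  \<open>1 / a\<close>, whose mass is 1.\<close>

lemma nn_integral_gaussian_1d:
  assumes "a > 0"
  shows "(\<integral>\<^sup>+y. ennreal (exp (- (a * y\<^sup>2) / 2)) \<partial>lborel) = ennreal (sqrt (2 * pi / a))"
proof -
  define s where "s = 1 / sqrt a"
  have s: "s > 0" "s\<^sup>2 = 1 / a"
    using assms by (simp_all add: s_def power_divide)
  have eq: "exp (- (a * y\<^sup>2) / 2) = sqrt (2 * pi / a) * normal_density 0 s y" for y
    using assms by (simp add: normal_density_def s(2) real_sqrt_divide)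
  have "(\<integral>\<^sup>+y. ennreal (exp (- (a * y\<^sup>2) / 2)) \<partial>lborel)
      = ennreal (sqrt (2 * pi / a)) * (\<integral>\<^sup>+y. ennreal (normal_density 0 s y) \<partial>lborel)"
    unfolding eq using assms
    by (subst nn_integral_cmult[symmetric]) (auto simp: ennreal_mult)
  also have "(\<integral>\<^sup>+y. ennreal (normal_density 0 s y) \<partial>lborel) = 1"
    using s(1) by (subst nn_integral_eq_integral) auto
  finally show ?thesis by simp
qed

lemma prod_Basis_vec:
  fixes f :: "real^'n \<Rightarrow> 'b::comm_monoid_mult"
  shows "prod f Basis = (\<Prod>i\<in>UNIV. f (axis i 1))"
proof -
  have B: "Basis = range (\<lambda>i. axis i (1::real) :: real^'n)"
    by (auto simp: Basis_vec_def)
  have "inj (\<lambda>i. axis i (1::real) :: real^'n)"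
    by (auto simp: inj_on_def axis_eq_axis)
  then show ?thesis
    unfolding B by (simp only: prod.reindex o_def)
qed

lemma sum_Basis_vec:
  fixes f :: "real^'n \<Rightarrow> 'b::comm_monoid_add"
  shows "sum f Basis = (\<Sum>i\<in>UNIV. f (axis i 1))"
proof -
  have B: "Basis = range (\<lambda>i. axis i (1::real) :: real^'n)"
    by (auto simp: Basis_vec_def)
  have "inj (\<lambda>i. axis i (1::real) :: real^'n)"
    by (auto simp: inj_on_def axis_eq_axis)
  then show ?thesis
    unfolding B by (simp only: sum.reindex o_def)
qed

lemma gaussian_diagonal:
  fixes a :: "'n::finite \<Rightarrow> real"
  assumes "\<And>i. a i > 0"
  shows "has_bochner_integral lborel (\<lambda>w::real^'n. exp (- (\<Sum>i\<in>UNIV. a i * (w $ i)\<^sup>2) / 2))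
           (\<Prod>i\<in>UNIV. sqrt (2 * pi / a i))"
proof (rule has_bochner_integral_nn_integral)
  \<comment> \<open>Fubini over coordinates wants factors indexed by basis vectors. As
    \<open>axis\<close> is injective, the sum has one nonzero term at \<open>b = axis i 1\<close>,
    namely the factor for coordinate \<open>i\<close>.\<close>
  define f :: "real^'n \<Rightarrow> real \<Rightarrow> ennreal"
    where "f b y = (\<Sum>i\<in>UNIV. if b = axis i 1 then ennreal (exp (- (a i * y\<^sup>2) / 2)) else 0)" for b y
  have f: "f (axis i 1) = (\<lambda>y. ennreal (exp (- (a i * y\<^sup>2) / 2)))" for i
    by (simp add: f_def axis_eq_axis fun_eq_iff)
  have "(\<integral>\<^sup>+w. ennreal (exp (- (\<Sum>i\<in>UNIV. a i * ((w::real^'n) $ i)\<^sup>2) / 2)) \<partial>lborel)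
      = (\<integral>\<^sup>+w. (\<Prod>b\<in>Basis. f b (w \<bullet> b)) \<partial>lborel)"
  proof (rule nn_integral_cong)
    fix w :: "real^'n"
    have "ennreal (exp (- (\<Sum>i\<in>UNIV. a i * (w $ i)\<^sup>2) / 2))
        = ennreal (\<Prod>i\<in>UNIV. exp (- (a i * (w $ i)\<^sup>2) / 2))"
      by (simp add: exp_sum[symmetric] sum_negf sum_divide_distrib)
    also have "\<dots> = (\<Prod>b\<in>Basis. f b (w \<bullet> b))"
      by (simp add: prod_Basis_vec f prod_ennreal inner_axis)
    finally show "ennreal (exp (- (\<Sum>i\<in>UNIV. a i * (w $ i)\<^sup>2) / 2)) = (\<Prod>b\<in>Basis. f b (w \<bullet> b))" .
  qed
  also have "\<dots> = (\<Prod>b\<in>Basis. \<integral>\<^sup>+y. f b y \<partial>lborel)"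
    by (rule nn_integral_lborel_prod) (auto simp: f_def)
  also have "\<dots> = (\<Prod>i\<in>UNIV. ennreal (sqrt (2 * pi / a i)))"
    by (simp only: prod_Basis_vec f nn_integral_gaussian_1d assms)
  also have "\<dots> = ennreal (\<Prod>i\<in>UNIV. sqrt (2 * pi / a i))"
    using assms by (simp add: prod_ennreal less_imp_le)
  finally show "(\<integral>\<^sup>+w. ennreal (exp (- (\<Sum>i\<in>UNIV. a i * ((w::real^'n) $ i)\<^sup>2) / 2)) \<partial>lborel)
      = ennreal (\<Prod>i\<in>UNIV. sqrt (2 * pi / a i))" .
qed (use assms in \<open>auto intro!: prod_nonneg simp: less_imp_le\<close>)

lemma inner_self_vec: "(w::real^'n) \<bullet> w = (\<Sum>i\<in>UNIV. (w $ i)\<^sup>2)"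
  by (simp add: inner_vec_def power2_eq_square)

lemma gaussian_isotropic:
  fixes \<alpha> :: real
  assumes "\<alpha> > 0"
  shows "has_bochner_integral lborel (\<lambda>w::real^'n. exp (- (\<alpha> * (w \<bullet> w)) / 2))
           (\<Prod>i\<in>(UNIV::'n set). sqrt (2 * pi / \<alpha>))"
  using gaussian_diagonal[of "\<lambda>_::'n. \<alpha>"] assms
  by (simp add: inner_self_vec sum_distrib_left)

text \<open>Half of the exponent absorbs the quadratic factor: with
  \<open>z = \<alpha> * (w \<bullet> w) / 4\<close>, the bound \<open>z * exp (- z) \<le> 1\<close>
  leaves a multiple of the wider Gaussian \<open>exp (- z)\<close>.\<close>

lemma integrable_gaussian_second_moment:
  assumes "\<alpha> > 0"
  shows "integrable lborel (\<lambda>w::real^'n. (w \<bullet> w) * exp (- (\<alpha> * (w \<bullet> w)) / 2))"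
proof (rule Bochner_Integration.integrable_bound)
  show "integrable lborel (\<lambda>w::real^'n. 4 / \<alpha> * exp (- (\<alpha> / 2 * (w \<bullet> w)) / 2))"
    using gaussian_isotropic[of "\<alpha> / 2"] assms
    by (intro integrable_mult_right) (auto simp: has_bochner_integral_iff)
  show "AE w in lborel. norm ((w \<bullet> w) * exp (- (\<alpha> * (w \<bullet> w)) / 2))
      \<le> norm (4 / \<alpha> * exp (- (\<alpha> / 2 * ((w::real^'n) \<bullet> w)) / 2))"
  proof (rule AE_I2)
    fix w :: "real^'n"
    define z where "z = \<alpha> * (w \<bullet> w) / 4"
    have z: "z \<le> exp z" using exp_ge_add_one_self[of z] by linarith
    have "(w \<bullet> w) * exp (- (\<alpha> * (w \<bullet> w)) / 2) = 4 / \<alpha> * (z * exp (- z)) * exp (- z)"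
      using assms by (simp add: z_def exp_add[symmetric] mult.assoc)
    also have "\<dots> \<le> 4 / \<alpha> * 1 * exp (- z)"
      using assms z by (intro mult_right_mono mult_left_mono) (auto simp: exp_minus field_simps)
    finally show "norm ((w \<bullet> w) * exp (- (\<alpha> * (w \<bullet> w)) / 2))
      \<le> norm (4 / \<alpha> * exp (- (\<alpha> / 2 * (w \<bullet> w)) / 2))"
      using assms by (simp add: z_def)
  qed
qed simp

section \<open>Coordinate reflections of Lebesgue measure\<close>

text \<open>A diagonal change of variables with entries 1 and -1 has Jacobian of absolute value
  1.\<close>

lemma lborel_reflect_coord:
  fixes i :: "'n::finite"
  shows "distr lborel borel (\<lambda>w::real^'n. \<chi> k. if k = i then - w $ k else w $ k) = lborel"
proof -
  define c :: "real^'n \<Rightarrow> real" where "c b = (if b = axis i 1 then -1 else 1)" for b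
  have T: "0 + (\<Sum>j\<in>Basis. (c j * (x \<bullet> j)) *\<^sub>R j) = (\<chi> k. if k = i then - x $ k else x $ k)" for x
  proof -
    have "(\<Sum>l\<in>UNIV. (c (axis l 1) * x $ l) * (axis l 1 :: real^'n) $ k)
        = (\<Sum>l\<in>UNIV. if k = l then (c (axis l 1) * x $ l) else 0)" for k
      by (rule sum.cong) (auto simp: axis_def)
    then have "(0 + (\<Sum>j\<in>Basis. (c j * (x \<bullet> j)) *\<^sub>R j)) $ k = c (axis k 1) * x $ k" for k
      by (simp add: sum_Basis_vec inner_axis)
    then show ?thesis
      by (intro iffD2[OF vec_eq_iff] allI) (simp add: c_def axis_eq_axis)
  qed
  have "(\<Prod>j\<in>Basis. \<bar>c j\<bar>) = 1" by (rule prod.neutral) (simp add: c_def)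
  then show ?thesis
    using lborel_affine_euclidean[of c 0] unfolding T by (simp add: c_def density_1)
qed

text \<open>By reflection invariance the integral equals its own negative. This removes the mixed
  products of coordinates under a diagonal Gaussian.\<close>

lemma integral_reflect_coord_odd:
  fixes f :: "real^'n \<Rightarrow> real"
  assumes [measurable]: "f \<in> borel_measurable borel"
    and "\<And>w. f (\<chi> k. if k = i then - w $ k else w $ k) = - f w"
  shows "integral\<^sup>L lborel f = 0"
proof -
  have [measurable]: "(\<lambda>w::real^'n. \<chi> k. if k = i then - w $ k else w $ k) \<in> borel_measurable borel"
  proof (intro borel_measurable_continuous_onI continuous_intros)
    show "continuous_on UNIV (\<lambda>w::real^'n. if k = i then - w $ k else w $ k)" for k
      by (cases "k = i") (auto intro!: continuous_intros)
  qed
  have "integral\<^sup>L lborel f = integral\<^sup>L (distr lborel borel (\<lambda>w::real^'n. \<chi> k. if k = i then - w $ k else w $ k)) f"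
    by (simp only: lborel_reflect_coord)
  also have "\<dots> = - integral\<^sup>L lborel f"
    by (simp add: integral_distr assms(2))
  finally show ?thesis by simp
qed

subsection \<open>Anisotropic Gaussian weights\<close>

text \<open>Unnormalised density of the centred Gaussian with precision matrix
  \<open>S + \<alpha>\<close>. A ridge \<open>\<alpha> > 0\<close> keeps it integrable when the
  positive semidefinite \<open>S\<close> is singular.\<close>

definition gauss_weight :: "real^'n^'n \<Rightarrow> real \<Rightarrow> real^'n \<Rightarrow> real" where
  "gauss_weight S \<alpha> w = exp (- (w \<bullet> (S *v w) + \<alpha> * (w \<bullet> w)) / 2)"

lemma continuous_on_matvec [continuous_intros]:
  fixes S :: "real^'n^'m"
  shows "continuous_on A f \<Longrightarrow> continuous_on A (\<lambda>w. S *v f w)"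
  by (rule bounded_linear.continuous_on[OF matrix_vector_mul_bounded_linear])

lemma borel_measurable_matvec [measurable]:
  "(\<lambda>w. (S::real^'n^'m) *v w) \<in> borel_measurable borel"
  by (intro borel_measurable_continuous_onI continuous_intros)

lemma borel_measurable_gauss_weight [measurable]: "gauss_weight S \<alpha> \<in> borel_measurable borel"
  unfolding gauss_weight_def by measurable

lemma gauss_weight_pos: "gauss_weight S \<alpha> w > 0"
  by (simp add: gauss_weight_def)

lemma gauss_weight_uminus: "gauss_weight S \<alpha> (- w) = gauss_weight S \<alpha> w"
  using matrix_vector_mult_diff_distrib[of S 0 w] by (simp add: gauss_weight_def)

lemma gauss_weight_le:
  assumes "pos_semidef S"
  shows "gauss_weight S \<alpha> w \<le> exp (- (\<alpha> * (w \<bullet> w)) / 2)"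
  using assms by (auto simp: gauss_weight_def pos_semidef_def)

lemma integrable_gauss_weight:
  fixes S :: "real^'n^'n"
  assumes "pos_semidef S" "\<alpha> > 0"
  shows "integrable lborel (gauss_weight S \<alpha>)"
proof (rule Bochner_Integration.integrable_bound)
  show "integrable lborel (\<lambda>w::real^'n. exp (- (\<alpha> * (w \<bullet> w)) / 2))"
    using gaussian_isotropic[OF assms(2), where 'n = 'n] by (simp add: has_bochner_integral_iff)
  show "AE w in lborel. norm (gauss_weight S \<alpha> w) \<le> norm (exp (- (\<alpha> * (w \<bullet> w)) / 2))"
    using gauss_weight_le[OF assms(1)] by (intro AE_I2) (simp add: abs_of_pos gauss_weight_pos)
qed simp

lemma pos_semidef_diag_nonneg:
  assumes "pos_semidef S"
  shows "S $ i $ i \<ge> 0"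
proof -
  have "axis i 1 \<bullet> (S *v axis i 1) \<ge> 0"
    using assms by (simp add: pos_semidef_def)
  then show ?thesis
    by (simp add: inner_axis' matrix_vector_mul_component inner_axis)
qed

lemma trace_nonneg: "pos_semidef S \<Longrightarrow> trace S \<ge> 0"
  unfolding trace_def by (intro sum_nonneg pos_semidef_diag_nonneg)

lemma quadratic_form_expand:
  "w \<bullet> ((S::real^'n^'n) *v w) = (\<Sum>i\<in>UNIV. S $ i $ i * (w $ i)\<^sup>2)
     + (\<Sum>i\<in>UNIV. \<Sum>j\<in>UNIV - {i}. S $ i $ j * (w $ i * w $ j))"
proof -
  have "w \<bullet> (S *v w) = (\<Sum>i\<in>UNIV. \<Sum>j\<in>UNIV. S $ i $ j * (w $ i * w $ j))"
    by (simp add: inner_vec_def matrix_vector_mult_def sum_distrib_left ac_simps)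
  also have "\<dots> = (\<Sum>i\<in>UNIV. S $ i $ i * (w $ i)\<^sup>2 + (\<Sum>j\<in>UNIV - {i}. S $ i $ j * (w $ i * w $ j)))"
    by (intro sum.cong refl, subst sum.remove[where x=i for i]) (auto simp: power2_eq_square)
  finally show ?thesis by (simp add: sum.distrib)
qed

text \<open>Hadamard's inequality \<open>det (1 + S/\<alpha>) \<le> \<Prod> (1 + S\<^sub>i\<^sub>i/\<alpha>)\<close> in integral form: the
  off-diagonal part of the quadratic form has mean zero under the diagonal Gaussian, so it
  can be dropped by \<open>exp (- y) \<ge> 1 - y\<close>.\<close>

lemma integral_gauss_weight_ge:
  fixes S :: "real^'n^'n"
  assumes S: "pos_semidef S" and a: "\<alpha> > 0"
  shows "exp (- trace S / (2 * \<alpha>)) * (\<integral>w. exp (- (\<alpha> * (w \<bullet> (w::real^'n))) / 2) \<partial>lborel)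
    \<le> integral\<^sup>L lborel (gauss_weight S \<alpha>)"
proof -
  define y where "y w = (\<Sum>i\<in>UNIV. \<Sum>j\<in>UNIV - {i}. S $ i $ j * (w $ i * w $ j))" for w :: "real^'n"
  define g where "g w = exp (- (\<Sum>i\<in>UNIV. (\<alpha> + S $ i $ i) * (w $ i)\<^sup>2) / 2)" for w :: "real^'n"
  have pos: "\<alpha> + S $ i $ i > 0" for i
    using pos_semidef_diag_nonneg[OF S, of i] a by simp
  have gw: "gauss_weight S \<alpha> w = exp (- (y w / 2)) * g w" for w
    unfolding gauss_weight_def g_def quadratic_form_expand y_def[symmetric] exp_add[symmetric]
    by (simp add: inner_self_vec sum_distrib_left sum.distrib distrib_right add_divide_distrib diff_divide_distrib)
  have g: "has_bochner_integral lborel g (\<Prod>i\<in>UNIV. sqrt (2 * pi / (\<alpha> + S $ i $ i)))"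
    unfolding g_def using gaussian_diagonal[OF pos] .
  have g_le: "g w \<le> exp (- (\<alpha> * (w \<bullet> w)) / 2)" for w
    using pos_semidef_diag_nonneg[OF S]
    by (simp add: g_def inner_self_vec sum_distrib_left sum_mono algebra_simps)
  have [measurable]: "g \<in> borel_measurable borel"
    using g by (auto simp: has_bochner_integral_iff)
  have int2: "integrable lborel (\<lambda>w. w $ i * w $ j * g w)" for i j
  proof (rule Bochner_Integration.integrable_bound[OF integrable_gaussian_second_moment[OF a]])
    show "AE w in lborel. norm (w $ i * w $ j * g w) \<le> norm ((w \<bullet> w) * exp (- (\<alpha> * ((w::real^'n) \<bullet> w)) / 2))"
    proof (rule AE_I2)
      fix w :: "real^'n"
      have "\<bar>w $ i * w $ j\<bar> \<le> norm w * norm w"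
        unfolding abs_mult by (intro mult_mono component_le_norm_cart) auto
      then have "\<bar>w $ i * w $ j\<bar> * g w \<le> (w \<bullet> w) * exp (- (\<alpha> * (w \<bullet> w)) / 2)"
        using g_le[of w] by (intro mult_mono) (auto simp: g_def dot_square_norm power2_eq_square)
      then show "norm (w $ i * w $ j * g w) \<le> norm ((w \<bullet> w) * exp (- (\<alpha> * (w \<bullet> w)) / 2))"
        by (simp add: abs_mult g_def)
    qed
  qed simp
  \<comment> \<open>Flipping the sign of coordinate \<open>i\<close> alone negates the product,
    since \<open>j \<noteq> i\<close>, and fixes \<open>g\<close>, which contains only
    squares.\<close>
  have zero: "(\<integral>w. w $ i * w $ j * g w \<partial>lborel) = 0" if "j \<noteq> i" for i j
  proof (rule integral_reflect_coord_odd[where i = i])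
    fix w :: "real^'n"
    have "g (\<chi> k. if k = i then - w $ k else w $ k) = g w"
      unfolding g_def by (rule arg_cong[where f = exp], rule arg_cong[where f = "\<lambda>z. - z / 2"], rule sum.cong) auto
    then show "(\<chi> k. if k = i then - w $ k else w $ k) $ i * (\<chi> k. if k = i then - w $ k else w $ k) $ j
        * g (\<chi> k. if k = i then - w $ k else w $ k) = - (w $ i * w $ j * g w)"
      using that by simp
  qed simp
  have yg: "y w * g w = (\<Sum>i\<in>UNIV. \<Sum>j\<in>UNIV - {i}. S $ i $ j * (w $ i * w $ j * g w))" for w
    by (simp add: y_def sum_distrib_right mult.assoc)
  have int_yg: "integrable lborel (\<lambda>w. y w * g w)"
    unfolding yg by (intro Bochner_Integration.integrable_sum integrable_mult_right int2)
  have zero_yg: "(\<integral>w. y w * g w \<partial>lborel) = 0"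
  proof -
    have "(\<integral>w. y w * g w \<partial>lborel)
        = (\<Sum>i\<in>UNIV. \<integral>w. (\<Sum>j\<in>UNIV - {i}. S $ i $ j * (w $ i * w $ j * g w)) \<partial>lborel)"
      unfolding yg
      by (intro Bochner_Integration.integral_sum Bochner_Integration.integrable_sum integrable_mult_right int2)
    also have "\<dots> = (\<Sum>i\<in>UNIV. \<Sum>j\<in>UNIV - {i}. \<integral>w. S $ i $ j * (w $ i * w $ j * g w) \<partial>lborel)"
      by (intro sum.cong refl Bochner_Integration.integral_sum integrable_mult_right int2)
    also have "\<dots> = 0"
      by (intro sum.neutral ballI) (simp add: zero)
    finally show ?thesis .
  qed
  have "exp (- trace S / (2 * \<alpha>)) * (\<integral>w. exp (- (\<alpha> * (w \<bullet> (w::real^'n))) / 2) \<partial>lborel)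
      = (\<Prod>i\<in>UNIV. exp (- (S $ i $ i / \<alpha>) / 2) * sqrt (2 * pi / \<alpha>))"
    using gaussian_isotropic[OF a, where 'n = 'n] a
    by (simp add: has_bochner_integral_iff prod.distrib exp_sum[symmetric] trace_def sum_negf
        sum_divide_distrib field_simps)
  \<comment> \<open>Factor by factor this is \<open>1 + z \<le> exp z\<close> at
    \<open>z = S $ i $ i / \<alpha>\<close>, taken under a square root.\<close>
  also have "\<dots> \<le> (\<Prod>i\<in>UNIV. sqrt (2 * pi / (\<alpha> + S $ i $ i)))"
  proof (intro prod_mono conjI)
    fix i
    have "\<alpha> + S $ i $ i \<le> \<alpha> * exp (S $ i $ i / \<alpha>)"
      using exp_ge_add_one_self[of "S $ i $ i / \<alpha>"] a by (simp add: field_simps)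
    then have "2 * pi / (\<alpha> * exp (S $ i $ i / \<alpha>)) \<le> 2 * pi / (\<alpha> + S $ i $ i)"
      using pos[of i] by (intro divide_left_mono mult_pos_pos) (auto simp: a)
    then have "exp (- (S $ i $ i / \<alpha>)) * (2 * pi / \<alpha>) \<le> 2 * pi / (\<alpha> + S $ i $ i)"
      by (simp add: exp_minus field_simps)
    then have "sqrt ((exp (- (S $ i $ i / \<alpha>) / 2))\<^sup>2 * (2 * pi / \<alpha>)) \<le> sqrt (2 * pi / (\<alpha> + S $ i $ i))"
      by (subst exp_double[symmetric]) (simp del: real_sqrt_divide)
    then show "exp (- (S $ i $ i / \<alpha>) / 2) * sqrt (2 * pi / \<alpha>) \<le> sqrt (2 * pi / (\<alpha> + S $ i $ i))"
      by (simp only: real_sqrt_mult real_sqrt_abs abs_exp_cancel)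
  qed (use a in auto)
  also have "\<dots> = (\<integral>w. g w - y w * g w / 2 \<partial>lborel)"
    using g int_yg zero_yg by (simp add: has_bochner_integral_iff)
  also have "\<dots> \<le> integral\<^sup>L lborel (gauss_weight S \<alpha>)"
  proof (rule integral_mono)
    show "integrable lborel (\<lambda>w. g w - y w * g w / 2)"
      using g int_yg by (simp add: has_bochner_integral_iff)
    show "g w - y w * g w / 2 \<le> gauss_weight S \<alpha> w" for w
    proof -
      have "(1 - y w / 2) * g w \<le> exp (- (y w / 2)) * g w"
        using exp_ge_add_one_self[of "- (y w / 2)"] by (intro mult_right_mono) (auto simp: g_def)
      then show ?thesis by (simp add: gw algebra_simps)
    qed
  qed (rule integrable_gauss_weight[OF S a])
  finally show ?thesis .
qed

text \<open>The cubic Taylor polynomial lies below \<open>exp\<close> because the remainder carries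
  an even power; averaging over \<open>y\<close> and \<open>- y\<close> cancels the odd
  terms.\<close>

lemma one_plus_square_half_le_cosh: "1 + y\<^sup>2 / 2 \<le> cosh (y::real)"
proof -
  have *: "1 + y + y\<^sup>2 / 2 + y ^ 3 / 6 \<le> exp y" for y :: real
  proof -
    obtain t where "exp y = (\<Sum>m<4. y ^ m / fact m) + exp t / fact 4 * y ^ 4"
      using Maclaurin_exp_le[of y 4] by blast
    moreover have "exp t / fact 4 * y ^ 4 \<ge> 0"
      by (intro mult_nonneg_nonneg) auto
    ultimately show ?thesis
      by (simp add: eval_nat_numeral)
  qed
  show ?thesis
    using *[of y] *[of "- y"] by (simp add: cosh_field_def)
qed

section \<open>Translations and second moments of the weight\<close>

lemma has_bochner_integral_translate:
  fixes f :: "'a::euclidean_space \<Rightarrow> real"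
  assumes "has_bochner_integral lborel f I"
  shows "has_bochner_integral lborel (\<lambda>w. f (a + w)) I"
proof -
  have m: "f \<in> borel_measurable borel"
    using assms by (auto simp: has_bochner_integral_iff)
  have "has_bochner_integral (distr lborel borel ((+) a)) f I"
    using assms by (simp add: lborel_distr_plus)
  then show ?thesis
    using m by (simp add: has_bochner_integral_iff integrable_distr_eq integral_distr)
qed

lemma nn_integral_translate:
  fixes f :: "'a::euclidean_space \<Rightarrow> ennreal"
  assumes [measurable]: "f \<in> borel_measurable borel"
  shows "(\<integral>\<^sup>+w. f (a + w) \<partial>lborel) = (\<integral>\<^sup>+w. f w \<partial>lborel)"
proof -
  have "(\<integral>\<^sup>+w. f w \<partial>lborel) = (\<integral>\<^sup>+w. f w \<partial>distr lborel borel ((+) a))"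
    by (simp only: lborel_distr_plus)
  then show ?thesis by (simp add: nn_integral_distr)
qed

lemma nn_integral_reflect:
  fixes f :: "'a::euclidean_space \<Rightarrow> ennreal"
  assumes [measurable]: "f \<in> borel_measurable borel"
  shows "(\<integral>\<^sup>+w. f (a - w) \<partial>lborel) = (\<integral>\<^sup>+w. f w \<partial>lborel)"
proof -
  have "lborel = distr lborel borel (\<lambda>w. a - w)"
    using lborel_affine[of "-1" a] by (simp add: density_1)
  then have "(\<integral>\<^sup>+w. f w \<partial>lborel) = (\<integral>\<^sup>+w. f w \<partial>distr lborel borel (\<lambda>w. a - w))"
    by simp
  then show ?thesis by (simp add: nn_integral_distr)
qed

lemma symmetric_matrix_inner:
  fixes S :: "real^'n^'n"
  assumes "transpose S = S"
  shows "v \<bullet> (S *v w) = (S *v v) \<bullet> w"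
  by (metis assms dot_lmul_matrix vector_transpose_matrix)

text \<open>By symmetry of \<open>S\<close> the two cross terms of the quadratic form agree, so a
  shift by \<open>a\<close> acts as an exponential tilt along
  \<open>(S + \<alpha>) a\<close>.\<close>

lemma gauss_weight_translate:
  fixes S :: "real^'n^'n"
  assumes "transpose S = S"
  shows "gauss_weight S \<alpha> (a + w) = gauss_weight S \<alpha> a * exp (- ((S *v a + \<alpha> *\<^sub>R a) \<bullet> w)) * gauss_weight S \<alpha> w"
proof -
  have "(a + w) \<bullet> (S *v (a + w)) + \<alpha> * ((a + w) \<bullet> (a + w))
      = (a \<bullet> (S *v a) + \<alpha> * (a \<bullet> a)) + 2 * ((S *v a + \<alpha> *\<^sub>R a) \<bullet> w) + (w \<bullet> (S *v w) + \<alpha> * (w \<bullet> w))"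
    using symmetric_matrix_inner[OF assms, of a w] inner_commute[of w "S *v a"]
    by (simp add: inner_add_left inner_add_right matrix_vector_right_distrib inner_commute[of w a] algebra_simps)
  then have eq: "- ((a + w) \<bullet> (S *v (a + w)) + \<alpha> * ((a + w) \<bullet> (a + w))) / 2
      = - (a \<bullet> (S *v a) + \<alpha> * (a \<bullet> a)) / 2 + - ((S *v a + \<alpha> *\<^sub>R a) \<bullet> w) + - (w \<bullet> (S *v w) + \<alpha> * (w \<bullet> w)) / 2"
    by (simp add: field_simps)
  show ?thesis
    unfolding gauss_weight_def eq exp_add ..
qed

text \<open>\<open>S + \<alpha>\<close> is coercive, hence injective, hence surjective in finite
  dimension. The bound comes from expanding the square of \<open>c - \<alpha> *\<^sub>R v\<close>
  and using coercivity for \<open>\<alpha> * (v \<bullet> v) \<le> c \<bullet> v\<close>.\<close>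

lemma regularised_solve:
  fixes S :: "real^'n^'n"
  assumes S: "pos_semidef S" and a: "\<alpha> > 0"
  obtains v where "S *v v + \<alpha> *\<^sub>R v = c" "\<alpha> * (c \<bullet> v) \<le> c \<bullet> c"
proof -
  define f where "f v = S *v v + \<alpha> *\<^sub>R v" for v
  have lin: "linear f"
    by (rule linearI) (auto simp: f_def matrix_vector_right_distrib scaleR_matrix_vector_assoc[symmetric] algebra_simps
        matrix_vector_mult_scaleR)
  have coerc: "\<alpha> * (v \<bullet> v) \<le> v \<bullet> f v" for v
    using S by (simp add: f_def inner_add_right pos_semidef_def)
  have "inj f"
  proof (subst linear_injective_0[OF lin], intro allI impI)
    fix v assume "f v = 0"
    then have "\<alpha> * (v \<bullet> v) \<le> 0" using coerc[of v] by simp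
    then show "v = 0"
      using a by (metis inner_eq_zero_iff inner_ge_zero mult_le_0_iff not_less order_antisym)
  qed
  then have "surj f" by (rule linear_injective_imp_surjective[OF lin _ refl])
  then obtain v where v: "f v = c" by (metis surjD)
  have "0 \<le> (c - \<alpha> *\<^sub>R v) \<bullet> (c - \<alpha> *\<^sub>R v)" by simp
  moreover have "\<alpha> * (\<alpha> * (v \<bullet> v)) \<le> \<alpha> * (c \<bullet> v)"
    using coerc[of v] a v by (intro mult_left_mono) (auto simp: inner_commute)
  ultimately have "\<alpha> * (c \<bullet> v) \<le> c \<bullet> c"
    by (simp add: inner_diff_left inner_diff_right inner_commute[of v c] right_diff_distrib)
  then show ?thesis using that[of v] v by (simp add: f_def)
qed

text \<open>Translating by \<open>\<plusminus>s v\<close>, where \<open>v\<close> is the covariance applied to \<open>c\<close>, leaves the integral of the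
  weight unchanged; averaging the two translates produces \<open>cosh (s (c \<bullet> w))\<close>, which dominates
  the square.\<close>

lemma gauss_weight_second_moment:
  fixes S :: "real^'n^'n"
  assumes S: "pos_semidef S" and a: "\<alpha> > 0"
  shows "integrable lborel (\<lambda>w. (c \<bullet> w)\<^sup>2 * gauss_weight S \<alpha> w)"
    and "(\<integral>w. (c \<bullet> w)\<^sup>2 * gauss_weight S \<alpha> w \<partial>lborel)
           \<le> 2 * (c \<bullet> c) / \<alpha> * integral\<^sup>L lborel (gauss_weight S \<alpha>)"
proof -
  let ?g = "gauss_weight S \<alpha>"
  let ?Z = "integral\<^sup>L lborel ?g"
  have S': "transpose S = S" using S by (simp add: pos_semidef_def)
  have g: "has_bochner_integral lborel ?g ?Z"
    using integrable_gauss_weight[OF S a] by (simp add: has_bochner_integral_iff)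
  have Z: "?Z \<ge> 0" by (intro integral_nonneg_AE AE_I2) (simp add: gauss_weight_pos less_imp_le)
  have "integrable lborel (\<lambda>w. (c \<bullet> w)\<^sup>2 * ?g w) \<and> (\<integral>w. (c \<bullet> w)\<^sup>2 * ?g w \<partial>lborel) \<le> 2 * (c \<bullet> c) / \<alpha> * ?Z"
  proof (cases "c = 0")
    case False
    obtain v where v: "S *v v + \<alpha> *\<^sub>R v = c" "\<alpha> * (c \<bullet> v) \<le> c \<bullet> c"
      using regularised_solve[OF S a] by blast
    \<comment> \<open>This is the variance of \<open>c \<bullet> w\<close> under the normalised
      weight.\<close>
    define h where "h = c \<bullet> v"
    have "v \<noteq> 0" using False v(1) by auto
    have h_eq: "h = v \<bullet> (S *v v) + \<alpha> * (v \<bullet> v)"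
      unfolding h_def v(1)[symmetric] by (simp add: inner_add_left inner_add_right inner_commute)
    have "v \<bullet> (S *v v) \<ge> 0" using S by (simp add: pos_semidef_def)
    then have h: "h > 0"
      using a \<open>v \<noteq> 0\<close> by (simp add: h_eq add_nonneg_pos)
    \<comment> \<open>Chosen so that \<open>s\<^sup>2 * h = 2\<close>: the shift then costs exactly
      \<open>exp (- 1)\<close>, and \<open>h * (s * (c \<bullet> w))\<^sup>2 / 2\<close> is
      \<open>(c \<bullet> w)\<^sup>2\<close>.\<close>
    define s where "s = sqrt (2 / h)"
    have s: "s\<^sup>2 = 2 / h" using h by (simp add: s_def)
    have gs: "?g (r *\<^sub>R v + w) = exp (- (r\<^sup>2 * h) / 2) * exp (- (r * (c \<bullet> w))) * ?g w" for r w
    proof -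
      have "?g (r *\<^sub>R v) = exp (- (r\<^sup>2 * h) / 2)"
        by (simp add: gauss_weight_def h_eq matrix_vector_mult_scaleR power2_eq_square algebra_simps)
      moreover have "S *v (r *\<^sub>R v) + \<alpha> *\<^sub>R (r *\<^sub>R v) = r *\<^sub>R c"
        by (simp add: v(1)[symmetric] matrix_vector_mult_scaleR scaleR_add_right)
      ultimately show ?thesis
        unfolding gauss_weight_translate[OF S'] by simp
    qed
    have two: "has_bochner_integral lborel (\<lambda>w. ?g (s *\<^sub>R v + w) + ?g ((- s) *\<^sub>R v + w)) (?Z + ?Z)"
      by (intro has_bochner_integral_add has_bochner_integral_translate g)
    have sum: "?g (s *\<^sub>R v + w) + ?g ((- s) *\<^sub>R v + w) = 2 * exp (- 1) * cosh (s * (c \<bullet> w)) * ?g w" for w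
      unfolding gs using h by (simp add: s cosh_field_def distrib_left distrib_right)
    have cosh: "has_bochner_integral lborel (\<lambda>w. h * exp 1 / 2 * (2 * exp (- 1) * cosh (s * (c \<bullet> w)) * ?g w)) (h * exp 1 / 2 * (2 * ?Z))"
      using two unfolding sum by (intro has_bochner_integral_mult_right) simp
    have "(\<lambda>w. h * exp 1 / 2 * (2 * exp (- 1) * cosh (s * (c \<bullet> w)) * ?g w)) = (\<lambda>w. h * (cosh (s * (c \<bullet> w)) * ?g w))"
      by (simp add: fun_eq_iff exp_minus)
    with cosh have cosh1: "has_bochner_integral lborel (\<lambda>w. h * (cosh (s * (c \<bullet> w)) * ?g w)) (h * exp 1 * ?Z)"
      by (simp add: mult.assoc)
    have cosh': "has_bochner_integral lborel (\<lambda>w. h * (cosh (s * (c \<bullet> w)) * ?g w) - h * ?g w) (h * exp 1 * ?Z - h * ?Z)"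
      by (rule has_bochner_integral_diff[OF cosh1 has_bochner_integral_mult_right]) (rule g)
    have le: "(c \<bullet> w)\<^sup>2 * ?g w \<le> h * (cosh (s * (c \<bullet> w)) * ?g w) - h * ?g w" for w
    proof -
      have "(c \<bullet> w)\<^sup>2 = h * ((s * (c \<bullet> w))\<^sup>2 / 2)"
        using h by (simp add: power_mult_distrib s)
      also have "\<dots> \<le> h * (cosh (s * (c \<bullet> w)) - 1)"
        using one_plus_square_half_le_cosh[of "s * (c \<bullet> w)"] h by (intro mult_left_mono) auto
      finally have "(c \<bullet> w)\<^sup>2 * ?g w \<le> h * (cosh (s * (c \<bullet> w)) - 1) * ?g w"
        by (rule mult_right_mono) (simp add: gauss_weight_pos less_imp_le)
      then show ?thesis by (simp add: algebra_simps)
    qed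
    have int: "integrable lborel (\<lambda>w. (c \<bullet> w)\<^sup>2 * ?g w)"
    proof (rule Bochner_Integration.integrable_bound)
      show "integrable lborel (\<lambda>w. h * (cosh (s * (c \<bullet> w)) * ?g w) - h * ?g w)"
        using cosh' by (simp add: has_bochner_integral_iff)
      show "AE w in lborel. norm ((c \<bullet> w)\<^sup>2 * ?g w) \<le> norm (h * (cosh (s * (c \<bullet> w)) * ?g w) - h * ?g w)"
      proof (rule AE_I2)
        fix w
        have "(c \<bullet> w)\<^sup>2 * ?g w \<ge> 0" by (simp add: gauss_weight_pos less_imp_le)
        then show "norm ((c \<bullet> w)\<^sup>2 * ?g w) \<le> norm (h * (cosh (s * (c \<bullet> w)) * ?g w) - h * ?g w)"
          using le[of w] unfolding real_norm_def by linarith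
      qed
    qed measurable
    have "(\<integral>w. (c \<bullet> w)\<^sup>2 * ?g w \<partial>lborel) \<le> h * exp 1 * ?Z - h * ?Z"
      using integral_mono[OF int _ le] cosh' by (simp only: has_bochner_integral_iff)
    also have "\<dots> = h * (exp 1 - 1) * ?Z" by (simp add: algebra_simps)
    \<comment> \<open>The exact second moment is \<open>h * ?Z\<close>; the cosh argument loses the
      factor \<open>exp 1 - 1\<close>, rounded up to 2.\<close>
    also have "\<dots> \<le> (c \<bullet> c) / \<alpha> * 2 * ?Z"
    proof (intro mult_right_mono mult_mono Z)
      show "h \<le> (c \<bullet> c) / \<alpha>" using v(2) a by (simp add: h_def field_simps)
      show "exp 1 - 1 \<le> (2::real)" using exp_le by simp
    qed (use a in auto)
    finally show ?thesis using int by (simp add: field_simps)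
  qed simp
  then show "integrable lborel (\<lambda>w. (c \<bullet> w)\<^sup>2 * gauss_weight S \<alpha> w)"
    and "(\<integral>w. (c \<bullet> w)\<^sup>2 * gauss_weight S \<alpha> w \<partial>lborel)
           \<le> 2 * (c \<bullet> c) / \<alpha> * integral\<^sup>L lborel (gauss_weight S \<alpha>)"
    by auto
qed

section \<open>Mass on sublevel sets and the tilted lower bound\<close>

lemma norm_matvec_square:
  "(norm ((C::real^'n^'m) *v w))\<^sup>2 = (\<Sum>i\<in>UNIV. (C $ i \<bullet> w)\<^sup>2)"
  by (simp add: norm_eq_sqrt_inner inner_self_vec matrix_mult_dot sum_nonneg)

lemma frob_norm_square: "(frob_norm C)\<^sup>2 = (\<Sum>i\<in>UNIV. C $ i \<bullet> C $ i)"
  by (simp add: frob_norm_def sum_nonneg inner_self_vec)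

text \<open>Chebyshev's inequality: summing the second moments over the rows of \<open>C\<close>
  gives at most \<open>2 * (frob_norm C)\<^sup>2 / \<alpha>\<close> times the mass, and the
  hypothesis makes this at most \<open>r\<^sup>2 / 2\<close> times the mass.\<close>

lemma half_le_integral_gauss_weight_sublevel:
  fixes S C :: "real^'n^'n"
  assumes S: "pos_semidef S" and a: "\<alpha> > 0" and r: "r > 0"
    and F: "4 * (frob_norm C)\<^sup>2 \<le> r\<^sup>2 * \<alpha>"
  shows "integral\<^sup>L lborel (gauss_weight S \<alpha>) / 2
    \<le> (\<integral>w. indicator {w. norm (C *v w) \<le> r} w * gauss_weight S \<alpha> w \<partial>lborel)"
proof -
  let ?g = "gauss_weight S \<alpha>"
  let ?Z = "integral\<^sup>L lborel ?g"
  let ?I = "indicator {w. norm (C *v w) \<le> r} :: real^'n \<Rightarrow> real"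
  have [measurable]: "{w. norm (C *v w) \<le> r} \<in> sets borel" by measurable
  have Z: "?Z \<ge> 0" by (intro integral_nonneg_AE AE_I2) (simp add: gauss_weight_pos less_imp_le)
  note g = integrable_gauss_weight[OF S a]
  have eq: "(norm (C *v w))\<^sup>2 * ?g w = (\<Sum>i\<in>UNIV. (C $ i \<bullet> w)\<^sup>2 * ?g w)" for w
    by (simp add: norm_matvec_square sum_distrib_right)
  have int: "integrable lborel (\<lambda>w. (norm (C *v w))\<^sup>2 * ?g w)"
    unfolding eq by (intro Bochner_Integration.integrable_sum gauss_weight_second_moment[OF S a])
  have "(\<integral>w. (norm (C *v w))\<^sup>2 * ?g w \<partial>lborel) = (\<Sum>i\<in>UNIV. \<integral>w. (C $ i \<bullet> w)\<^sup>2 * ?g w \<partial>lborel)"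
    unfolding eq by (intro Bochner_Integration.integral_sum gauss_weight_second_moment[OF S a])
  also have "\<dots> \<le> (\<Sum>i\<in>UNIV. 2 * (C $ i \<bullet> C $ i) / \<alpha> * ?Z)"
    by (intro sum_mono gauss_weight_second_moment[OF S a])
  also have "\<dots> = 2 * (frob_norm C)\<^sup>2 / \<alpha> * ?Z"
    by (simp add: frob_norm_square sum_distrib_left sum_distrib_right sum_divide_distrib)
  also have "\<dots> \<le> r\<^sup>2 / 2 * ?Z"
    using F a by (intro mult_right_mono Z) (simp add: field_simps)
  finally have m: "(\<integral>w. (norm (C *v w))\<^sup>2 * ?g w \<partial>lborel) \<le> r\<^sup>2 / 2 * ?Z" .
  have "?Z / 2 \<le> ?Z - (\<integral>w. (norm (C *v w))\<^sup>2 * ?g w \<partial>lborel) / r\<^sup>2"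
    using m r by (simp add: field_simps)
  also have "\<dots> = (\<integral>w. ?g w - (norm (C *v w))\<^sup>2 * ?g w / r\<^sup>2 \<partial>lborel)"
    using g int by simp
  also have "\<dots> \<le> (\<integral>w. ?I w * ?g w \<partial>lborel)"
  proof (rule integral_mono)
    show "integrable lborel (\<lambda>w. ?g w - (norm (C *v w))\<^sup>2 * ?g w / r\<^sup>2)"
      using g int by simp
    show "integrable lborel (\<lambda>w. ?I w * ?g w)"
      by (rule Bochner_Integration.integrable_bound[OF g]) (auto simp: indicator_def)
    fix w
    have "1 - (norm (C *v w))\<^sup>2 / r\<^sup>2 \<le> ?I w"
      using r by (auto simp: indicator_def field_simps not_le intro!: power_mono)
    then have "(1 - (norm (C *v w))\<^sup>2 / r\<^sup>2) * ?g w \<le> ?I w * ?g w"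
      by (rule mult_right_mono) (simp add: gauss_weight_pos less_imp_le)
    then show "?g w - (norm (C *v w))\<^sup>2 * ?g w / r\<^sup>2 \<le> ?I w * ?g w"
      by (simp add: algebra_simps)
  qed
  finally show ?thesis .
qed

lemma quadratic_form_le_op_norm: "v \<bullet> ((S::real^'n^'n) *v v) \<le> op_norm S * (v \<bullet> v)"
proof -
  have "v \<bullet> (S *v v) \<le> norm v * norm (S *v v)" by (rule norm_cauchy_schwarz)
  also have "\<dots> \<le> norm v * (op_norm S * norm v)"
    by (intro mult_left_mono onorm matrix_vector_mul_bounded_linear) auto
  finally show ?thesis by (simp add: dot_square_norm power2_eq_square mult_ac)
qed

text \<open>The weight is recentred at \<open>\<theta> y / \<parallel>y\<parallel>\<close>; the remaining linear term integrates over a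
  symmetric set and only helps.\<close>

lemma tilted_integral_ge:
  fixes S C :: "real^'n^'n"
  assumes S: "pos_semidef S" and a: "\<alpha> > 0" and r: "r > 0" and \<theta>: "\<theta> \<ge> 0"
    and F: "4 * (frob_norm C)\<^sup>2 \<le> r\<^sup>2 * \<alpha>" and C: "\<theta> * op_norm C + r \<le> 1"
    and y: "norm y \<ge> s" "s > 0"
  shows "ennreal (exp (\<theta> * s - \<theta>\<^sup>2 * (op_norm S + \<alpha>) / 2) * (integral\<^sup>L lborel (gauss_weight S \<alpha>) / 2))
    \<le> (\<integral>\<^sup>+v. ennreal (indicator {v. norm (C *v v) \<le> 1} v * (exp (y \<bullet> v) * gauss_weight S \<alpha> v)) \<partial>lborel)"
proof -
  let ?g = "gauss_weight S \<alpha>"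
  let ?I = "\<lambda>r. indicator {w. norm (C *v w) \<le> r} :: real^'n \<Rightarrow> real"
  have [measurable]: "{w. norm (C *v w) \<le> r} \<in> sets borel" for r by measurable
  define f where "f v = ?I 1 v * (exp (y \<bullet> v) * ?g v)" for v
  have f0: "f v \<ge> 0" for v by (simp add: f_def gauss_weight_pos less_imp_le)
  have [measurable]: "f \<in> borel_measurable borel" unfolding f_def[abs_def] by measurable
  have S': "transpose S = S" using S by (simp add: pos_semidef_def)
  define u where "u = (\<theta> / norm y) *\<^sub>R y"
  have nu: "norm u = \<theta>" using y \<theta> by (auto simp: u_def)
  then have uu: "u \<bullet> u = \<theta>\<^sup>2" by (simp add: dot_square_norm)
  have yu: "y \<bullet> u = \<theta> * norm y" using y by (simp add: u_def dot_square_norm power2_eq_square)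
  define k where "k = exp (\<theta> * s - \<theta>\<^sup>2 * (op_norm S + \<alpha>) / 2)"
  \<comment> \<open>The linear term gains \<open>\<theta> * norm y \<ge> \<theta> * s\<close>, while
    the quadratic form at \<open>u\<close> is at most
    \<open>\<theta>\<^sup>2 * op_norm S\<close>.\<close>
  have k: "k \<le> exp (y \<bullet> u) * ?g u"
  proof -
    have "\<theta> * s \<le> \<theta> * norm y" using y \<theta> by (intro mult_left_mono)
    then show ?thesis
      using quadratic_form_le_op_norm[of u S]
      unfolding k_def gauss_weight_def exp_add[symmetric] yu uu by (simp add: algebra_simps) (simp add: field_simps)
  qed
  have Cle: "norm (C *v (u + w)) \<le> 1" if "norm (C *v w) \<le> r" for w
  proof -
    have "norm (C *v (u + w)) \<le> norm (C *v u) + norm (C *v w)"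
      by (simp add: matrix_vector_right_distrib norm_triangle_ineq)
    also have "norm (C *v u) \<le> op_norm C * norm u"
      by (intro onorm matrix_vector_mul_bounded_linear)
    finally show ?thesis using that C by (simp add: nu mult.commute)
  qed
  \<comment> \<open>Pairing \<open>w\<close> with \<open>- w\<close> turns the leftover tilt
    \<open>exp l\<close> into \<open>2 * cosh l \<ge> 2\<close>. Both points \<open>u + w\<close>
    and \<open>u - w\<close> stay in the region where \<open>f\<close> is positive.\<close>
  have key: "2 * (k * (?I r w * ?g w)) \<le> f (u + w) + f (u - w)" for w
  proof (cases "norm (C *v w) \<le> r")
    case True
    define l where "l = y \<bullet> w - (S *v u + \<alpha> *\<^sub>R u) \<bullet> w"
    have 1: "f (u + w) = exp (y \<bullet> u) * ?g u * exp l * ?g w"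
      using Cle[OF True] gauss_weight_translate[OF S', of \<alpha> u w]
      by (simp add: f_def l_def inner_add_right exp_add exp_diff exp_minus field_simps)
    have 2: "f (u - w) = exp (y \<bullet> u) * ?g u * exp (- l) * ?g w"
      using Cle[of "- w"] True gauss_weight_translate[OF S', of \<alpha> u "- w"] matrix_vector_mult_diff_distrib[of C 0 w]
      by (simp add: f_def l_def inner_diff_right exp_diff exp_minus gauss_weight_uminus field_simps)
    have "2 * (k * ?g w) \<le> 2 * (exp (y \<bullet> u) * ?g u * ?g w)"
      using k by (simp add: gauss_weight_pos mult_right_mono)
    also have "\<dots> \<le> 2 * (exp (y \<bullet> u) * ?g u * ?g w) * cosh l"
      using mult_left_mono[OF cosh_real_ge_1[of l], of "2 * (exp (y \<bullet> u) * ?g u * ?g w)"]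
      by (simp add: gauss_weight_pos less_imp_le)
    also have "\<dots> = f (u + w) + f (u - w)"
      unfolding 1 2 by (simp add: cosh_field_def algebra_simps)
    finally show ?thesis using True by simp
  qed (simp add: f0)
  have Z: "k * (integral\<^sup>L lborel ?g / 2) \<le> k * (\<integral>w. ?I r w * ?g w \<partial>lborel)"
    using half_le_integral_gauss_weight_sublevel[OF S a r F] by (intro mult_left_mono) (auto simp: k_def)
  have int: "integrable lborel (\<lambda>w. ?I r w * ?g w)"
    by (rule Bochner_Integration.integrable_bound[OF integrable_gauss_weight[OF S a]]) (auto simp: indicator_def)
  have "2 * ennreal (k * (\<integral>w. ?I r w * ?g w \<partial>lborel)) = ennreal (\<integral>w. 2 * (k * (?I r w * ?g w)) \<partial>lborel)"
    using int by (simp add: ennreal_mult' ennreal_numeral[symmetric] del: ennreal_numeral)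
  also have "\<dots> = (\<integral>\<^sup>+w. ennreal (2 * (k * (?I r w * ?g w))) \<partial>lborel)"
    using int by (intro nn_integral_eq_integral[symmetric] integrable_mult_right AE_I2)
      (auto simp: k_def gauss_weight_pos less_imp_le)
  also have "\<dots> \<le> (\<integral>\<^sup>+w. ennreal (f (u + w)) + ennreal (f (u - w)) \<partial>lborel)"
    using key by (intro nn_integral_mono) (simp add: ennreal_plus[symmetric] f0 ennreal_leI del: ennreal_plus)
  also have "\<dots> = (\<integral>\<^sup>+w. ennreal (f (u + w)) \<partial>lborel) + (\<integral>\<^sup>+w. ennreal (f (u - w)) \<partial>lborel)"
    by (intro nn_integral_add) auto
  \<comment> \<open>Lebesgue measure is invariant under both \<open>w \<mapsto> u + w\<close> and
    \<open>w \<mapsto> u - w\<close>.\<close>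
  also have "\<dots> = 2 * (\<integral>\<^sup>+w. ennreal (f w) \<partial>lborel)"
    using nn_integral_translate[of "\<lambda>w. ennreal (f w)" u] nn_integral_reflect[of "\<lambda>w. ennreal (f w)" u]
    by (simp add: mult_2)
  finally have "ennreal (k * (\<integral>w. ?I r w * ?g w \<partial>lborel)) \<le> (\<integral>\<^sup>+w. ennreal (f w) \<partial>lborel)"
    by (simp add: ennreal_mult_le_mult_iff)
  then show ?thesis
    using Z unfolding f_def k_def by (meson ennreal_leI order_trans)
qed

subsection \<open>Subgamma vectors\<close>

text \<open>The parameter 1 is admissible for \<open>v\<close> once
  \<open>norm (C *v v) \<le> 1\<close>; if \<open>C *v v = 0\<close> the admissible range is
  unbounded.\<close>

lemma subgamma_moment_le:
  assumes "subgamma M x S C" "norm (C *v v) \<le> 1"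
  shows "integrable M (\<lambda>\<omega>. exp (x \<omega> \<bullet> v))"
    and "(\<integral>\<omega>. exp (x \<omega> \<bullet> v) \<partial>M) \<le> exp (v \<bullet> (S *v v) / 2)"
proof -
  have "ereal \<bar>1\<bar> \<le> frac_inf 1 (norm (C *v v))"
    using assms(2) by (auto simp: frac_inf_def field_simps)
  then show "integrable M (\<lambda>\<omega>. exp (x \<omega> \<bullet> v))" "(\<integral>\<omega>. exp (x \<omega> \<bullet> v) \<partial>M) \<le> exp (v \<bullet> (S *v v) / 2)"
    using assms(1)[unfolded subgamma_def, rule_format, of 1 v] by auto
qed

text \<open>After exchanging the integrals, the moment bound cancels the \<open>S\<close> part of
  the weight on the admissible set, and the integrand vanishes off it. Only the isotropic Gaussian
  remains.\<close>

lemma subgamma_tilted_expectation_le: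
  fixes S C :: "real^'n^'n"
  assumes "prob_space M" and [measurable]: "x \<in> borel_measurable M"
    and sg: "subgamma M x S C" and a: "\<alpha> > 0"
  shows "(\<integral>\<^sup>+\<omega>. (\<integral>\<^sup>+v. ennreal (indicator {v. norm (C *v v) \<le> 1} v * (exp (x \<omega> \<bullet> v) * gauss_weight S \<alpha> v)) \<partial>lborel) \<partial>M)
    \<le> ennreal (\<integral>w. exp (- (\<alpha> * (w \<bullet> (w::real^'n))) / 2) \<partial>lborel)"
proof -
  interpret prob_space M by fact
  interpret pair_sigma_finite M "lborel :: (real^'n) measure" ..
  let ?I = "indicator {v. norm (C *v v) \<le> 1} :: real^'n \<Rightarrow> real"
  let ?g = "gauss_weight S \<alpha>"
  have [measurable]: "{w. norm (C *v w) \<le> 1} \<in> sets borel" by measurable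
  have "(\<integral>\<^sup>+\<omega>. (\<integral>\<^sup>+v. ennreal (?I v * (exp (x \<omega> \<bullet> v) * ?g v)) \<partial>lborel) \<partial>M)
      = (\<integral>\<^sup>+v. (\<integral>\<^sup>+\<omega>. ennreal (?I v * (exp (x \<omega> \<bullet> v) * ?g v)) \<partial>M) \<partial>lborel)"
    by (rule Fubini'[symmetric]) measurable
  also have "\<dots> \<le> (\<integral>\<^sup>+w. ennreal (exp (- (\<alpha> * (w \<bullet> (w::real^'n))) / 2)) \<partial>lborel)"
  proof (rule nn_integral_mono)
    fix v :: "real^'n"
    show "(\<integral>\<^sup>+\<omega>. ennreal (?I v * (exp (x \<omega> \<bullet> v) * ?g v)) \<partial>M) \<le> ennreal (exp (- (\<alpha> * (v \<bullet> v)) / 2))"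
    proof (cases "norm (C *v v) \<le> 1")
      case True
      note m = subgamma_moment_le[OF sg True]
      have "(\<integral>\<^sup>+\<omega>. ennreal (?I v * (exp (x \<omega> \<bullet> v) * ?g v)) \<partial>M) = ennreal ((\<integral>\<omega>. exp (x \<omega> \<bullet> v) \<partial>M) * ?g v)"
        using True m(1)
        by (subst nn_integral_eq_integral) (auto simp: gauss_weight_pos less_imp_le)
      also have "\<dots> \<le> ennreal (exp (v \<bullet> (S *v v) / 2) * ?g v)"
        using m(2) by (intro ennreal_leI mult_right_mono) (auto simp: gauss_weight_pos less_imp_le)
      also have "exp (v \<bullet> (S *v v) / 2) * ?g v = exp (- (\<alpha> * (v \<bullet> v)) / 2)"
        by (simp add: gauss_weight_def exp_add[symmetric] field_simps)
      finally show ?thesis .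
    qed simp
  qed
  also have "\<dots> = ennreal (\<integral>w. exp (- (\<alpha> * (w \<bullet> (w::real^'n))) / 2) \<partial>lborel)"
    using gaussian_isotropic[OF a, where 'n = 'n]
    by (intro nn_integral_eq_integral) (auto simp: has_bochner_integral_iff)
  finally show ?thesis .
qed

text \<open>Markov's inequality for the tilted integral: it is at least \<open>b\<close> on the tail
  event and has expectation at most \<open>Z\<close>. The isotropic mass \<open>Z\<close> also
  appears in the lower bound for \<open>b\<close> and cancels.\<close>

lemma subgamma_norm_tail_aux:
  fixes S C :: "real^'n^'n"
  assumes M: "prob_space M" and S: "pos_semidef S" and x[measurable]: "x \<in> borel_measurable M"
    and sg: "subgamma M x S C"
    and a: "\<alpha> > 0" and r: "r > 0" and \<theta>: "\<theta> \<ge> 0" and s: "s > 0"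
    and F: "4 * (frob_norm C)\<^sup>2 \<le> r\<^sup>2 * \<alpha>" and C: "\<theta> * op_norm C + r \<le> 1"
  shows "measure M {\<omega> \<in> space M. norm (x \<omega>) \<ge> s}
    \<le> 2 * exp (trace S / (2 * \<alpha>) + \<theta>\<^sup>2 * (op_norm S + \<alpha>) / 2 - \<theta> * s)"
proof -
  interpret prob_space M by fact
  let ?A = "{\<omega> \<in> space M. norm (x \<omega>) \<ge> s}"
  define Z where "Z = (\<integral>w. exp (- (\<alpha> * (w \<bullet> (w::real^'n))) / 2) \<partial>lborel)"
  define k where "k = exp (\<theta> * s - \<theta>\<^sup>2 * (op_norm S + \<alpha>) / 2)"
  define b where "b = k * (integral\<^sup>L lborel (gauss_weight S \<alpha>) / 2)"
  have Z: "Z > 0"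
    using gaussian_isotropic[OF a, where 'n = 'n] a
    by (auto simp: has_bochner_integral_iff Z_def intro!: prod_pos)
  have b: "k * exp (- trace S / (2 * \<alpha>)) * Z / 2 \<le> b"
    using integral_gauss_weight_ge[OF S a] by (simp add: b_def k_def Z_def mult.assoc)
  have b0: "b \<ge> 0" using b Z by (smt (verit) k_def exp_gt_zero mult_pos_pos half_gt_zero)
  have "ennreal (b * measure M ?A) = (\<integral>\<^sup>+\<omega>. ennreal b * indicator ?A \<omega> \<partial>M)"
    using b0 by (simp add: nn_integral_cmult_indicator emeasure_eq_measure ennreal_mult)
  also have "\<dots> \<le> (\<integral>\<^sup>+\<omega>. (\<integral>\<^sup>+v. ennreal (indicator {v. norm (C *v v) \<le> 1} v * (exp (x \<omega> \<bullet> v) * gauss_weight S \<alpha> v)) \<partial>lborel) \<partial>M)"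
    using tilted_integral_ge[OF S a r \<theta> F C _ s]
    by (intro nn_integral_mono) (auto simp: indicator_def b_def k_def)
  also have "\<dots> \<le> ennreal Z"
    unfolding Z_def by (rule subgamma_tilted_expectation_le[OF M x sg a])
  finally have "b * measure M ?A \<le> Z"
    using Z by (simp add: ennreal_le_iff)
  moreover have "k * exp (- trace S / (2 * \<alpha>)) * Z / 2 * measure M ?A \<le> b * measure M ?A"
    by (intro mult_right_mono b) simp
  ultimately have "Z * (k * exp (- trace S / (2 * \<alpha>)) / 2 * measure M ?A) \<le> Z * 1"
    by (simp add: field_simps)
  then have "k * exp (- trace S / (2 * \<alpha>)) / 2 * measure M ?A \<le> 1"
    using Z by (simp only: mult_le_cancel_left_pos)
  moreover have "k * exp (- trace S / (2 * \<alpha>))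
      = exp (- (trace S / (2 * \<alpha>) + \<theta>\<^sup>2 * (op_norm S + \<alpha>) / 2 - \<theta> * s))"
    by (simp add: k_def exp_add[symmetric])
  ultimately show ?thesis
    by (simp only: exp_minus) (simp add: field_simps)
qed

section \<open>Choice of parameters, tail bound and quantile bound\<close>

lemma op_norm_nonneg: "op_norm (S::real^'n^'n) \<ge> 0"
  by (rule onorm_pos_le[OF matrix_vector_mul_bounded_linear])

text \<open>The real \<open>m\<close> stands for any lower bound of the minimum; multiplying out the
  denominators avoids infinite fractions.\<close>

lemma subgamma_norm_tail:
  fixes S C :: "real^'n^'n"
  assumes M: "prob_space M" and S: "pos_semidef S" and x: "x \<in> borel_measurable M"
    and sg: "subgamma M x S C" and t: "t > 0"
    and mS: "m * op_norm S \<le> t\<^sup>2" and mC: "m * op_norm C \<le> t"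
    and mF: "m * (frob_norm C)\<^sup>2 \<le> 2 * t * sqrt (trace S) + t\<^sup>2"
  shows "measure M {\<omega> \<in> space M. norm (x \<omega>) \<ge> sqrt (trace S) + t} \<le> 2 * exp (- m / 16)"
proof (cases "m > 0")
  \<comment> \<open>For \<open>m \<le> 0\<close> the right-hand side is at least 2.\<close>
  case False
  have "measure M {\<omega> \<in> space M. norm (x \<omega>) \<ge> sqrt (trace S) + t} \<le> 1"
    by (rule prob_space.prob_le_1[OF M])
  also have "1 \<le> 2 * exp (- m / 16)"
    using False one_le_exp_iff[of "- m / 16"] by linarith
  finally show ?thesis .
next
  case m: True
  define R where "R = sqrt (trace S)"
  have R: "R \<ge> 0" "R\<^sup>2 = trace S" using trace_nonneg[OF S] by (simp_all add: R_def)
  \<comment> \<open>The budget \<open>\<theta> * op_norm C + r \<le> 1\<close> is split as 1/10 for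
    the shift and \<open>r = 9 / 10\<close> for the sublevel set.\<close>
  define \<theta> where "\<theta> = m / (10 * t)"
  define \<alpha> where "\<alpha> = (R + t / 2) / \<theta>"
  have \<theta>: "\<theta> > 0" using m t by (simp add: \<theta>_def)
  have a: "\<alpha> > 0" using R t \<theta> by (simp add: \<alpha>_def add_nonneg_pos)
  have \<theta>t: "\<theta> * t = m / 10" using t by (simp add: \<theta>_def)
  have \<theta>C: "\<theta> * op_norm C + 9 / 10 \<le> 1"
    using mC t by (simp add: \<theta>_def field_simps)
  have F: "4 * (frob_norm C)\<^sup>2 \<le> (9 / 10)\<^sup>2 * \<alpha>"
  proof -
    have "m * (4 * (frob_norm C)\<^sup>2) \<le> 4 * (2 * t * R + t\<^sup>2)" using mF by (simp add: R_def)
    also have "\<dots> = 8 * (t * (R + t / 2))" by (simp add: algebra_simps power2_eq_square)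
    \<comment> \<open>The constant is \<open>10 * (9 / 10)\<^sup>2\<close>, which is what \<alpha>
      provides.\<close>
    also have "\<dots> \<le> (81 / 10) * (t * (R + t / 2))" using t R by (intro mult_right_mono) auto
    also have "\<dots> = m * ((9 / 10)\<^sup>2 * \<alpha>)"
      using m t by (simp add: \<alpha>_def \<theta>_def power2_eq_square field_simps)
    finally show ?thesis using m by simp
  qed
  have "measure M {\<omega> \<in> space M. norm (x \<omega>) \<ge> R + t}
      \<le> 2 * exp (trace S / (2 * \<alpha>) + \<theta>\<^sup>2 * (op_norm S + \<alpha>) / 2 - \<theta> * (R + t))"
    using R t \<theta> by (intro subgamma_norm_tail_aux[OF M S x sg a _ _ _ F \<theta>C]) auto
  also have "\<dots> \<le> 2 * exp (- m / 16)"
  proof -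
    have 1: "trace S / (2 * \<alpha>) \<le> \<theta> * R / 2"
    proof -
      have "R * R / (R + t / 2) \<le> R"
        using R t by (simp add: divide_le_eq add_nonneg_pos distrib_left)
      then have "\<theta> / 2 * (R * R / (R + t / 2)) \<le> \<theta> / 2 * R"
        using \<theta> by (intro mult_left_mono) auto
      moreover have "trace S / (2 * \<alpha>) = \<theta> / 2 * (R * R / (R + t / 2))"
        by (simp add: \<alpha>_def R(2)[symmetric] power2_eq_square)
      ultimately show ?thesis by simp
    qed
    have 2: "\<theta>\<^sup>2 * \<alpha> = \<theta> * R + \<theta> * t / 2"
    proof -
      have "\<theta>\<^sup>2 * \<alpha> = \<theta> * (R + t / 2)"
        using \<theta> by (simp add: \<alpha>_def power2_eq_square)
      then show ?thesis by (simp add: distrib_left)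
    qed
    have 3: "\<theta>\<^sup>2 * op_norm S \<le> m / 100"
    proof -
      have "m * (m * op_norm S) \<le> m * t\<^sup>2" using mS m by (intro mult_left_mono) auto
      then show ?thesis using t by (simp add: \<theta>_def power_divide field_simps power2_eq_square)
    qed
    \<comment> \<open>All terms in \<open>\<theta> * R\<close> cancel, leaving at most
      \<open>m / 200 - 3 / 4 * (m / 10) = - 7 * m / 100\<close>, which is below
      \<open>- m / 16\<close>.\<close>
    have "trace S / (2 * \<alpha>) + \<theta>\<^sup>2 * (op_norm S + \<alpha>) / 2 - \<theta> * (R + t) \<le> - m / 16"
    proof -
      have "\<theta>\<^sup>2 * (op_norm S + \<alpha>) = \<theta>\<^sup>2 * op_norm S + \<theta>\<^sup>2 * \<alpha>" "\<theta> * (R + t) = \<theta> * R + \<theta> * t"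
        by (simp_all add: distrib_left)
      then show ?thesis using 1 2 3 \<theta>t m by linarith
    qed
    then show ?thesis by simp
  qed
  finally show ?thesis by (simp add: R_def)
qed

lemma frac_inf_nonneg: "a \<ge> 0 \<Longrightarrow> b \<ge> 0 \<Longrightarrow> frac_inf a b \<ge> 0"
  by (simp add: frac_inf_def)

text \<open>If the fraction is infinite then \<open>b = 0\<close>, and the product form reduces to
  \<open>0 \<le> a\<close>.\<close>

lemma le_frac_infD: "ereal m \<le> frac_inf a b \<Longrightarrow> a \<ge> 0 \<Longrightarrow> b \<ge> 0 \<Longrightarrow> m * b \<le> a"
  by (auto simp: frac_inf_def field_simps split: if_splits)

lemma subgamma_norm_tail_ereal:
  fixes S C :: "real^'n^'n"
  assumes M: "prob_space M" and S: "pos_semidef S" and x: "x \<in> borel_measurable M"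
    and sg: "subgamma M x S C" and t: "t > 0"
  shows "ereal (measure M {\<omega> \<in> space M. norm (x \<omega>) \<ge> sqrt (trace S) + t})
        \<le> 2 * exp_ereal (ereal (- 1 / 16) *
            min (frac_inf (t\<^sup>2) (op_norm S))
              (min (frac_inf t (op_norm C))
                (frac_inf (2 * t * sqrt (trace S) + t\<^sup>2) ((frob_norm C)\<^sup>2))))"
    (is "ereal ?p \<le> 2 * exp_ereal (_ * min ?A (min ?B ?C))")
proof -
  define X where "X = min ?A (min ?B ?C)"
  have R: "2 * t * sqrt (trace S) + t\<^sup>2 \<ge> 0"
    using t trace_nonneg[OF S] by simp
  have "?A \<ge> 0" "?B \<ge> 0" "?C \<ge> 0"
    using t R by (simp_all add: frac_inf_nonneg op_norm_nonneg)
  then have X0: "X \<ge> 0" by (simp add: X_def)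
  have tail: "?p \<le> 2 * exp (- m / 16)" if "ereal m \<le> X" for m
  proof -
    have m: "ereal m \<le> ?A" "ereal m \<le> ?B" "ereal m \<le> ?C"
      using that by (simp_all add: X_def)
    show ?thesis
      by (rule subgamma_norm_tail[OF M S x sg t le_frac_infD[OF m(1)] le_frac_infD[OF m(2)] le_frac_infD[OF m(3)]])
         (use t R in \<open>simp_all add: op_norm_nonneg\<close>)
  qed
  have "ereal ?p \<le> 2 * exp_ereal (ereal (- 1 / 16) * X)"
  proof (cases X)
    case (real m)
    then have "?p \<le> 2 * exp (- m / 16)" by (intro tail) simp
    then show ?thesis by (simp add: real exp_ereal_def)
  next
    case PInf
    \<comment> \<open>An infinite minimum allows every \<open>m\<close>; this one makes
      \<open>2 * exp (- m / 16)\<close> equal to \<open>y\<close>, so the probability is below every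
      positive number.\<close>
    have "?p \<le> 0 + y" if "y > 0" for y
      using tail[of "- 16 * ln (y / 2)"] that by (simp add: PInf)
    then have "?p \<le> 0" by (rule field_le_epsilon)
    moreover have "exp_ereal (ereal (- 1 / 16) * X) = 0"
      by (simp add: PInf exp_ereal_def)
    ultimately show ?thesis by simp
  qed (use X0 in simp)
  then show ?thesis by (simp only: X_def)
qed

text \<open>The tail bound is applied at every \<open>t' > t\<close> rather than at \<open>t\<close> itself, since \<open>t\<close> may vanish.\<close>

lemma subgamma_norm_quantile:
  fixes S C :: "real^'n^'n"
  assumes M: "prob_space M" and S: "pos_semidef S" and x[measurable]: "x \<in> borel_measurable M"
    and sg: "subgamma M x S C" and t: "t \<ge> 0" and \<delta>: "\<delta> > 0"
    and tS: "16 * ln (2 / \<delta>) * op_norm S \<le> t\<^sup>2" and tC: "16 * ln (2 / \<delta>) * op_norm C \<le> t"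
    and tF: "16 * ln (2 / \<delta>) * (frob_norm C)\<^sup>2 \<le> 2 * t * sqrt (trace S) + t\<^sup>2"
  shows "measure M {\<omega> \<in> space M. norm (x \<omega>) \<le> sqrt (trace S) + t} \<ge> 1 - \<delta>"
proof -
  interpret prob_space M by fact
  let ?R = "sqrt (trace S)"
  define A where "A n = {\<omega> \<in> space M. norm (x \<omega>) \<ge> ?R + (t + 1 / real (Suc n))}" for n
  have R: "?R \<ge> 0" using trace_nonneg[OF S] by simp
  have A: "prob (A n) \<le> \<delta>" for n
  proof -
    define t' where "t' = t + 1 / real (Suc n)"
    have t': "t' > 0" "t \<le> t'" using t by (simp_all add: t'_def add_nonneg_pos)
    have t2: "t\<^sup>2 \<le> t'\<^sup>2" using t t' by (intro power_mono) auto
    have "2 * t * ?R \<le> 2 * t' * ?R" using R t' by (intro mult_right_mono) auto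
    then have "prob {\<omega> \<in> space M. norm (x \<omega>) \<ge> ?R + t'} \<le> 2 * exp (- (16 * ln (2 / \<delta>)) / 16)"
      using t' t2 tS tC tF by (intro subgamma_norm_tail[OF M S x sg]) auto
    also have "\<dots> = \<delta>" using \<delta> by (simp add: exp_minus)
    finally show ?thesis by (simp add: A_def t'_def)
  qed
  have sets: "range A \<subseteq> sets M" by (auto simp: A_def)
  have "incseq A"
  proof (rule incseq_SucI, unfold A_def, safe)
    fix n \<omega> assume "?R + (t + 1 / real (Suc n)) \<le> norm (x \<omega>)"
    moreover have "1 / real (Suc (Suc n)) \<le> 1 / real (Suc n)" by (simp add: field_simps)
    ultimately show "?R + (t + 1 / real (Suc (Suc n))) \<le> norm (x \<omega>)" by linarith
  qed
  \<comment> \<open>Continuity from below carries the uniform bound to the union, the event that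
    \<open>norm (x \<omega>)\<close> strictly exceeds \<open>?R + t\<close>.\<close>
  then have "(\<lambda>n. prob (A n)) \<longlonglongrightarrow> prob (\<Union>n. A n)"
    by (rule finite_Lim_measure_incseq[OF sets])
  then have U: "prob (\<Union>n. A n) \<le> \<delta>"
    using A by (intro LIMSEQ_le_const2) auto
  have "space M - (\<Union>n. A n) \<subseteq> {\<omega> \<in> space M. norm (x \<omega>) \<le> ?R + t}"
  proof safe
    fix \<omega> assume \<omega>: "\<omega> \<in> space M" "\<omega> \<notin> (\<Union>n. A n)"
    show "norm (x \<omega>) \<le> ?R + t"
    proof (rule field_le_epsilon)
      fix e :: real assume "e > 0"
      then obtain n where "1 / real (Suc n) < e" using nat_approx_posE by blast
      moreover have "\<not> ?R + (t + 1 / real (Suc n)) \<le> norm (x \<omega>)"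
        using \<omega> by (auto simp: A_def)
      ultimately show "norm (x \<omega>) \<le> ?R + t + e" by linarith
    qed
  qed
  then have "prob (space M - (\<Union>n. A n)) \<le> prob {\<omega> \<in> space M. norm (x \<omega>) \<le> ?R + t}"
    by (intro finite_measure_mono) auto
  moreover have "prob (space M - (\<Union>n. A n)) = 1 - prob (\<Union>n. A n)"
    using sets by (intro prob_compl) auto
  ultimately show ?thesis using U by linarith
qed

theorem theorem5p1:
  fixes M :: "'a measure"
    and x :: "'a \<Rightarrow> real^'d"
    and S C :: "real^'d^'d"
  assumes "prob_space M"
    and "pos_semidef S"
    and "x \<in> borel_measurable M"
    and "integrable M x" and "(\<integral>\<omega>. x \<omega> \<partial>M) = 0"
    and "subgamma M x S C"
  shows "(\<forall>t>0.
      ereal (measure M {\<omega> \<in> space M. norm (x \<omega>) \<ge> sqrt (trace S) + t})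
        \<le> 2 * exp_ereal (ereal (- 1 / 16) *
            min (frac_inf (t\<^sup>2) (op_norm S))
              (min (frac_inf t (op_norm C))
                (frac_inf (2 * t * sqrt (trace S) + t\<^sup>2) ((frob_norm C)\<^sup>2)))))
    \<and> (\<forall>\<delta>. 0 < \<delta> \<and> \<delta> < 1 \<longrightarrow>
      measure M {\<omega> \<in> space M.
          ereal (norm (x \<omega>)) \<le>
            ereal (sqrt (trace S) + 4 * sqrt (op_norm S * ln (2 / \<delta>))
                   + 16 * op_norm C * ln (2 / \<delta>))
            + min (ereal (4 * frob_norm C * sqrt (ln (2 / \<delta>))))
                (frac_inf (8 * (frob_norm C)\<^sup>2) (sqrt (trace S)) * ereal (ln (2 / \<delta>)))}
        \<ge> 1 - \<delta>)"
proof (intro conjI allI impI)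
  fix \<delta> :: real assume \<delta>: "0 < \<delta> \<and> \<delta> < 1"
  define L where "L = ln (2 / \<delta>)"
  define R where "R = sqrt (trace S)"
  define F where "F = frob_norm C"
  have L: "L > 0" using \<delta> by (simp add: L_def)
  have R: "R \<ge> 0" using trace_nonneg[OF assms(2)] by (simp add: R_def)
  have F: "F \<ge> 0" by (simp add: F_def frob_norm_def sum_nonneg)
  have C: "op_norm C \<ge> 0" and S: "op_norm S \<ge> 0" by (rule op_norm_nonneg)+
  \<comment> \<open>Whichever term attains the minimum, it solves the Frobenius condition: the
    fraction makes \<open>2 * d * R\<close> equal to \<open>16 * L * F\<^sup>2\<close>, the root
    makes \<open>d\<^sup>2\<close> equal to it. If \<open>R = 0\<close>, then \<open>L > 0\<close>
    keeps the fraction term infinite and the root is taken.\<close>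
  obtain d where d: "min (ereal (4 * F * sqrt L)) (frac_inf (8 * F\<^sup>2) R * ereal L) = ereal d"
    "d \<ge> 0" "16 * L * F\<^sup>2 \<le> 2 * d * R + d\<^sup>2"
  proof (cases "R > 0 \<and> 8 * F\<^sup>2 / R * L \<le> 4 * F * sqrt L")
    case True
    show ?thesis
    proof (rule that[of "8 * F\<^sup>2 / R * L"])
      show "min (ereal (4 * F * sqrt L)) (frac_inf (8 * F\<^sup>2) R * ereal L) = ereal (8 * F\<^sup>2 / R * L)"
        using True by (simp add: frac_inf_def)
    qed (use True L in auto)
  next
    case False
    show ?thesis
    proof (rule that[of "4 * F * sqrt L"])
      show "min (ereal (4 * F * sqrt L)) (frac_inf (8 * F\<^sup>2) R * ereal L) = ereal (4 * F * sqrt L)"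
        using False R L by (auto simp: frac_inf_def min_def)
      show "16 * L * F\<^sup>2 \<le> 2 * (4 * F * sqrt L) * R + (4 * F * sqrt L)\<^sup>2"
        using L F R by (simp add: power_mult_distrib)
    qed (use L F in auto)
  qed
  define a where "a = 4 * sqrt (op_norm S * L)"
  \<comment> \<open>Each of the three nonnegative summands alone meets one condition of the quantile
    bound, for \<open>S\<close>, \<open>C\<close> and the Frobenius norm in turn; these conditions
    persist when \<open>t\<close> grows.\<close>
  define t where "t = a + 16 * op_norm C * L + d"
  have a: "a \<ge> 0" "a\<^sup>2 = 16 * L * op_norm S"
    using S L by (simp_all add: a_def power_mult_distrib)
  have c: "16 * op_norm C * L \<ge> 0" using C L by simp
  have t: "t \<ge> 0" "a \<le> t" "d \<le> t" "16 * op_norm C * L \<le> t"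
    using a c d(2) by (simp_all add: t_def)
  have "measure M {\<omega> \<in> space M. norm (x \<omega>) \<le> sqrt (trace S) + t} \<ge> 1 - \<delta>"
  proof (rule subgamma_norm_quantile[OF assms(1-3,6) t(1)])
    show "16 * ln (2 / \<delta>) * op_norm S \<le> t\<^sup>2"
      using power_mono[OF t(2) a(1), of 2] a(2) by (simp add: L_def)
    show "16 * ln (2 / \<delta>) * op_norm C \<le> t"
      using t(4) by (simp add: L_def mult_ac)
    have "2 * d * R \<le> 2 * t * R" using t(3) R by (intro mult_right_mono) auto
    then show "16 * ln (2 / \<delta>) * (frob_norm C)\<^sup>2 \<le> 2 * t * sqrt (trace S) + t\<^sup>2"
      using d(3) power_mono[OF t(3) d(2), of 2] by (simp add: L_def F_def R_def)
  qed (use \<delta> in auto)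
  then show "measure M {\<omega> \<in> space M.
          ereal (norm (x \<omega>)) \<le>
            ereal (sqrt (trace S) + 4 * sqrt (op_norm S * ln (2 / \<delta>))
                   + 16 * op_norm C * ln (2 / \<delta>))
            + min (ereal (4 * frob_norm C * sqrt (ln (2 / \<delta>))))
                (frac_inf (8 * (frob_norm C)\<^sup>2) (sqrt (trace S)) * ereal (ln (2 / \<delta>)))}
        \<ge> 1 - \<delta>"
    unfolding d(1)[unfolded L_def F_def R_def] by (simp add: t_def a_def L_def add.assoc)
qed (rule subgamma_norm_tail_ereal[OF assms(1-3,6)])

end
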